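(* Let $M$ be an EMV-algebra. Then the set $\mathcal J_s(M)$ of strong Jordan signed measures on $M$, with pointwise addition, scalar multiplication and the pointwise order, is an $\ell$-group which is also a Riesz space (lattice-ordered real vector space).
   Context: An EMV-algebra is an algebra $(M;\vee,\wedge,\oplus,0)$ of type $\langle 2,2,2,0\rangle$ such that: (i) $(M;\oplus,0)$ is a commutative monoid with neutral element $0$; (ii) $(M;\vee,\wedge,0)$ is a distributive lattice with bottom $0$; (iii) for each idempotent $a$ ($a\oplus a=a$; set $\mathcal I(M)$), $([0,a];\oplus,\lambda_a,0,a)$ is an MV-algebra, where $[0,a]=\{x:0\le x\le a\}$ and $\lambda_a(x)=\min\{z\in[0,a]:z\oplus x=a\}$; (iv) each element lies below some idempotent. For $x,y\le a\in\mathcal I(M)$, $x\odot y=\lambda_a(\lambda_a(x)\oplus\lambda_a(y))$; $x+y$ is defined iff $x\odot y=0$ and then equals $x\oplus y$. A measure on $M$ is a map $m:M\to[0,\infty)$ with $m(x+y)=m(x)+m(y)$ whenever $x+y$ is defined. A strong measure is a measure $m$ for which there is $a\in M$ with $m(a)=\sup\{m(x):x\in M\}$. A strong Jordan signed measure is a difference of two strong measures. *)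

theory Defs
  imports "HOL-Library.Extended_Real" "HOL-Algebra.Module" "HOL-Algebra.Lattice"
begin

section \<open>MV-algebras and EMV-algebras\<close>

locale mv_algebra =
  fixes A :: "'a set" and plus :: "'a \<Rightarrow> 'a \<Rightarrow> 'a" and neg :: "'a \<Rightarrow> 'a" and z :: 'a and u :: 'a
  assumes plus_comm_monoid: "Group.comm_monoid \<lparr>carrier = A, monoid.mult = plus, one = z\<rparr>"
    and neg_closed: "x \<in> A \<Longrightarrow> neg x \<in> A"
    and neg_zero: "neg z = u"
    and neg_neg: "x \<in> A \<Longrightarrow> neg (neg x) = x"
    and plus_unit: "x \<in> A \<Longrightarrow> plus x u = u"
    and lukasiewicz: "x \<in> A \<Longrightarrow> y \<in> A \<Longrightarrow>
      plus (neg (plus (neg x) y)) y = plus (neg (plus (neg y) x)) x"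

record 'a emv = "'a partial_object" +
  emv_sup :: "'a \<Rightarrow> 'a \<Rightarrow> 'a" (infixl "\<curlyvee>\<index>" 65)
  emv_inf :: "'a \<Rightarrow> 'a \<Rightarrow> 'a" (infixl "\<curlywedge>\<index>" 70)
  emv_plus :: "'a \<Rightarrow> 'a \<Rightarrow> 'a" (infixl "\<boxplus>\<index>" 65)
  emv_zero :: 'a ("\<^bold>0\<index>")

definition emv_order :: "('a, 'm) emv_scheme \<Rightarrow> 'a gorder" where
  "emv_order M = \<lparr>carrier = carrier M, eq = (=), le = (\<lambda>x y. x \<curlywedge>\<^bsub>M\<^esub> y = x)\<rparr>"

definition emv_idempotents :: "('a, 'm) emv_scheme \<Rightarrow> 'a set" where
  "emv_idempotents M = {a \<in> carrier M. a \<boxplus>\<^bsub>M\<^esub> a = a}"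

definition emv_interval :: "('a, 'm) emv_scheme \<Rightarrow> 'a \<Rightarrow> 'a set" where
  "emv_interval M a = {x \<in> carrier M. \<^bold>0\<^bsub>M\<^esub> \<sqsubseteq>\<^bsub>emv_order M\<^esub> x \<and> x \<sqsubseteq>\<^bsub>emv_order M\<^esub> a}"

definition is_emv_neg :: "('a, 'm) emv_scheme \<Rightarrow> 'a \<Rightarrow> 'a \<Rightarrow> 'a \<Rightarrow> bool" where
  "is_emv_neg M a x y \<longleftrightarrow> least (emv_order M) y {z \<in> emv_interval M a. z \<boxplus>\<^bsub>M\<^esub> x = a}"

definition emv_neg :: "('a, 'm) emv_scheme \<Rightarrow> 'a \<Rightarrow> 'a \<Rightarrow> 'a" where
  "emv_neg M a x = (THE y. is_emv_neg M a x y)"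

locale emv_algebra =
  fixes M :: "('a, 'm) emv_scheme" (structure)
  assumes plus_comm_monoid:
      "Group.comm_monoid \<lparr>carrier = carrier M, monoid.mult = (\<boxplus>), one = \<^bold>0\<rparr>"
    and sup_closed: "x \<in> carrier M \<Longrightarrow> y \<in> carrier M \<Longrightarrow> x \<curlyvee> y \<in> carrier M"
    and inf_closed: "x \<in> carrier M \<Longrightarrow> y \<in> carrier M \<Longrightarrow> x \<curlywedge> y \<in> carrier M"
    and sup_assoc: "x \<in> carrier M \<Longrightarrow> y \<in> carrier M \<Longrightarrow> z \<in> carrier M \<Longrightarrow>
      (x \<curlyvee> y) \<curlyvee> z = x \<curlyvee> (y \<curlyvee> z)"
    and inf_assoc: "x \<in> carrier M \<Longrightarrow> y \<in> carrier M \<Longrightarrow> z \<in> carrier M \<Longrightarrow>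
      (x \<curlywedge> y) \<curlywedge> z = x \<curlywedge> (y \<curlywedge> z)"
    and sup_commute: "x \<in> carrier M \<Longrightarrow> y \<in> carrier M \<Longrightarrow> x \<curlyvee> y = y \<curlyvee> x"
    and inf_commute: "x \<in> carrier M \<Longrightarrow> y \<in> carrier M \<Longrightarrow> x \<curlywedge> y = y \<curlywedge> x"
    and sup_inf_absorb: "x \<in> carrier M \<Longrightarrow> y \<in> carrier M \<Longrightarrow> x \<curlyvee> (x \<curlywedge> y) = x"
    and inf_sup_absorb: "x \<in> carrier M \<Longrightarrow> y \<in> carrier M \<Longrightarrow> x \<curlywedge> (x \<curlyvee> y) = x"
    and inf_sup_distrib: "x \<in> carrier M \<Longrightarrow> y \<in> carrier M \<Longrightarrow> z \<in> carrier M \<Longrightarrow>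
      x \<curlywedge> (y \<curlyvee> z) = (x \<curlywedge> y) \<curlyvee> (x \<curlywedge> z)"
    and zero_least: "x \<in> carrier M \<Longrightarrow> \<^bold>0 \<sqsubseteq>\<^bsub>emv_order M\<^esub> x"
    and neg_exists: "a \<in> emv_idempotents M \<Longrightarrow> x \<in> emv_interval M a \<Longrightarrow> \<exists>y. is_emv_neg M a x y"
    and interval_mv: "a \<in> emv_idempotents M \<Longrightarrow>
      mv_algebra (emv_interval M a) (\<boxplus>) (emv_neg M a) \<^bold>0 a"
    and idempotent_above: "x \<in> carrier M \<Longrightarrow> \<exists>a \<in> emv_idempotents M. x \<sqsubseteq>\<^bsub>emv_order M\<^esub> a"


section \<open>Measures\<close>

definition emv_times :: "('a, 'm) emv_scheme \<Rightarrow> 'a \<Rightarrow> 'a \<Rightarrow> 'a \<Rightarrow> 'a" where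
  "emv_times M a x y = emv_neg M a (emv_neg M a x \<boxplus>\<^bsub>M\<^esub> emv_neg M a y)"

text \<open>In an EMV-algebra \<open>emv_times M a x y\<close> is the same for all idempotents \<open>a\<close> above \<open>x\<close> and
  \<open>y\<close>, so it does not matter which one witnesses that the partial sum is defined.\<close>

definition emv_sum_defined :: "('a, 'm) emv_scheme \<Rightarrow> 'a \<Rightarrow> 'a \<Rightarrow> bool" where
  "emv_sum_defined M x y \<longleftrightarrow> (\<exists>a \<in> emv_idempotents M.
     x \<in> emv_interval M a \<and> y \<in> emv_interval M a \<and> emv_times M a x y = \<^bold>0\<^bsub>M\<^esub>)"

text \<open>Functions on \<open>M\<close> are extensional: they take the value \<open>undefined\<close> off the carrier.\<close>

definition emv_measures :: "('a, 'm) emv_scheme \<Rightarrow> ('a \<Rightarrow> real) set" where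
  "emv_measures M = {m \<in> carrier M \<rightarrow>\<^sub>E {0..}.
     \<forall>x \<in> carrier M. \<forall>y \<in> carrier M. emv_sum_defined M x y \<longrightarrow> m (x \<boxplus>\<^bsub>M\<^esub> y) = m x + m y}"

text \<open>The supremum is taken in the extended reals, where it always exists; for a strong measure
  it is therefore finite.\<close>

definition emv_strong_measures :: "('a, 'm) emv_scheme \<Rightarrow> ('a \<Rightarrow> real) set" where
  "emv_strong_measures M = {m \<in> emv_measures M.
     \<exists>a \<in> carrier M. ereal (m a) = (SUP x \<in> carrier M. ereal (m x))}"

definition strong_jordan :: "('a, 'm) emv_scheme \<Rightarrow> ('a \<Rightarrow> real) set" where
  "strong_jordan M = {restrict (\<lambda>x. m1 x - m2 x) (carrier M) | m1 m2.
     m1 \<in> emv_strong_measures M \<and> m2 \<in> emv_strong_measures M}"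


section \<open>Lattice-ordered groups and Riesz spaces\<close>

locale l_group = Group.group G + Lattice.lattice L for G (structure) and L +
  assumes carrier_eq: "carrier G = carrier L"
    and mult_left_mono: "\<lbrakk>x \<in> carrier G; y \<in> carrier G; z \<in> carrier G; x \<sqsubseteq>\<^bsub>L\<^esub> y\<rbrakk> \<Longrightarrow>
      z \<otimes> x \<sqsubseteq>\<^bsub>L\<^esub> z \<otimes> y"
    and mult_right_mono: "\<lbrakk>x \<in> carrier G; y \<in> carrier G; z \<in> carrier G; x \<sqsubseteq>\<^bsub>L\<^esub> y\<rbrakk> \<Longrightarrow>
      x \<otimes> z \<sqsubseteq>\<^bsub>L\<^esub> y \<otimes> z"

definition real_ring :: "real ring" where
  "real_ring = \<lparr>carrier = UNIV, monoid.mult = (*), one = 1, zero = 0, add = (+)\<rparr>"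

locale riesz_space = Module.module real_ring V + Lattice.lattice L for V (structure) and L +
  assumes carrier_eq: "carrier V = carrier L"
    and add_mono: "\<lbrakk>x \<in> carrier V; y \<in> carrier V; z \<in> carrier V; x \<sqsubseteq>\<^bsub>L\<^esub> y\<rbrakk> \<Longrightarrow>
      x \<oplus>\<^bsub>V\<^esub> z \<sqsubseteq>\<^bsub>L\<^esub> y \<oplus>\<^bsub>V\<^esub> z"
    and smult_mono: "\<lbrakk>x \<in> carrier V; y \<in> carrier V; x \<sqsubseteq>\<^bsub>L\<^esub> y; 0 \<le> r\<rbrakk> \<Longrightarrow>
      r \<odot>\<^bsub>V\<^esub> x \<sqsubseteq>\<^bsub>L\<^esub> r \<odot>\<^bsub>V\<^esub> y"

text \<open>The record type \<^typ>\<open>('a, 'b) module\<close> inherits the fields \<open>mult\<close> and \<open>one\<close> from rings;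
  the locale \<^locale>\<open>module\<close> ignores them.\<close>

definition strong_jordan_space :: "('a, 'm) emv_scheme \<Rightarrow> (real, 'a \<Rightarrow> real) module" where
  "strong_jordan_space M =
     \<lparr>carrier = strong_jordan M, monoid.mult = undefined, one = undefined,
      zero = restrict (\<lambda>x. 0) (carrier M),
      add = (\<lambda>m1 m2. restrict (\<lambda>x. m1 x + m2 x) (carrier M)),
      smult = (\<lambda>r m. restrict (\<lambda>x. r * m x) (carrier M))\<rparr>"

definition strong_jordan_order :: "('a, 'm) emv_scheme \<Rightarrow> ('a \<Rightarrow> real) gorder" where
  "strong_jordan_order M =
     \<lparr>carrier = strong_jordan M, eq = (=), le = (\<lambda>m1 m2. \<forall>x \<in> carrier M. m1 x \<le> m2 x)\<rparr>"

end

theory Submission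
  imports Defs
begin

text \<open>Inside an MV-algebra \<open>[0, a]\<close> the partial sum has the Riesz decomposition property: two
  decompositions of one element have a common refinement. Any two partial sums of \<open>M\<close> live in a
  common \<open>[0, a]\<close>, so \<open>M\<close> inherits this property. Hence for measures \<open>m\<close> and \<open>n\<close> the map
  \<open>x \<mapsto> inf {m p + n q | p + q = x}\<close> is additive, and it is the infimum of \<open>m\<close> and \<open>n\<close> among all
  additive maps. It is strong, because a measure below a strong one attains its maximum at the same
  point. Infima of differences of strong measures follow by translation, suprema by negation.\<close>

section \<open>Riesz decomposition in MV-algebras\<close>

context mv_algebra
begin

section \<open>Basic laws of sum and negation\<close>

lemma plus_monoid: "Group.monoid \<lparr>carrier = A, monoid.mult = plus, one = z\<rparr>"
  using plus_comm_monoid by (rule comm_monoid.axioms)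

lemma plus_closed [simp]: "x \<in> A \<Longrightarrow> y \<in> A \<Longrightarrow> plus x y \<in> A"
  using monoid.m_closed[OF plus_monoid, of x y] by simp

lemma z_closed [simp]: "z \<in> A"
  using monoid.one_closed[OF plus_monoid] by simp

lemma plus_assoc: "x \<in> A \<Longrightarrow> y \<in> A \<Longrightarrow> w \<in> A \<Longrightarrow> plus (plus x y) w = plus x (plus y w)"
  using monoid.m_assoc[OF plus_monoid, of x y w] by simp

lemma plus_commute: "x \<in> A \<Longrightarrow> y \<in> A \<Longrightarrow> plus x y = plus y x"
  using comm_monoid.m_comm[OF plus_comm_monoid, of x y] by simp

lemma plus_left_commute:
  "x \<in> A \<Longrightarrow> y \<in> A \<Longrightarrow> w \<in> A \<Longrightarrow> plus x (plus y w) = plus y (plus x w)"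
  by (metis plus_assoc plus_commute)

lemmas plus_ac = plus_assoc plus_commute plus_left_commute

lemma plus_z [simp]: "x \<in> A \<Longrightarrow> plus x z = x" "x \<in> A \<Longrightarrow> plus z x = x"
  using monoid.r_one[OF plus_monoid, of x] monoid.l_one[OF plus_monoid, of x] by simp_all

lemma u_closed [simp]: "u \<in> A"
  using neg_closed[OF z_closed] neg_zero by simp

lemmas [simp] = neg_closed neg_neg neg_zero plus_unit

lemma neg_u [simp]: "neg u = z"
  using neg_neg[OF z_closed] by simp

lemma u_plus [simp]: "x \<in> A \<Longrightarrow> plus u x = u"
  using plus_commute[of u x] by simp

text \<open>The Lukasiewicz axiom at \<open>y = u\<close>: one side collapses to \<open>u\<close>,
  the other is \<open>plus (neg x) x\<close>.\<close>

lemma neg_plus_self: "x \<in> A \<Longrightarrow> plus (neg x) x = u"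
  using lukasiewicz[of x u] by simp

lemma plus_neg_self: "x \<in> A \<Longrightarrow> plus x (neg x) = u"
  using neg_plus_self plus_commute by simp

lemma plus_left_neg_self: "x \<in> A \<Longrightarrow> y \<in> A \<Longrightarrow> plus x (plus y (neg x)) = u"
  using plus_left_commute[of x y "neg x"] by (simp add: plus_neg_self)

section \<open>Natural order, truncated difference and partial sum\<close>

definition mv_le :: "'a \<Rightarrow> 'a \<Rightarrow> bool" where
  "mv_le x y \<longleftrightarrow> plus (neg x) y = u"

text \<open>Truncated difference; on the real unit interval it is
  \<open>max 0 (x - y)\<close>.\<close>

definition mv_minus :: "'a \<Rightarrow> 'a \<Rightarrow> 'a" where
  "mv_minus x y = neg (plus (neg x) y)"

text \<open>The lattice meet of the natural order, written as a difference so that \<open>x\<close>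
  splits into the meet and \<open>mv_minus x y\<close>.\<close>

definition mv_meet :: "'a \<Rightarrow> 'a \<Rightarrow> 'a" where
  "mv_meet x y = mv_minus x (mv_minus x y)"

text \<open>The vanishing of the MV-product, with the outer negation removed; on the real unit
  interval it says that \<open>x + y\<close> is at most \<open>1\<close>.\<close>

definition mv_summable :: "'a \<Rightarrow> 'a \<Rightarrow> bool" where
  "mv_summable x y \<longleftrightarrow> x \<in> A \<and> y \<in> A \<and> plus (neg x) (neg y) = u"

lemma mv_summable_iff:
  "mv_summable x y \<longleftrightarrow> x \<in> A \<and> y \<in> A \<and> neg (plus (neg x) (neg y)) = z"
  unfolding mv_summable_def by (metis neg_closed neg_neg neg_u neg_zero plus_closed)

lemma mv_summable_iff_le: "mv_summable x y \<longleftrightarrow> x \<in> A \<and> y \<in> A \<and> mv_le x (neg y)"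
  unfolding mv_summable_def mv_le_def by blast

lemma mv_minus_closed [simp]: "x \<in> A \<Longrightarrow> y \<in> A \<Longrightarrow> mv_minus x y \<in> A"
  by (simp add: mv_minus_def)

text \<open>The two sides of the Lukasiewicz axiom are \<open>(x - y) + y\<close> and
  \<open>(y - x) + x\<close> with truncated differences; for \<open>x\<close> below \<open>y\<close>
  the difference \<open>x - y\<close> is \<open>z\<close>.\<close>

lemma mv_minus_plus_of_le: "x \<in> A \<Longrightarrow> y \<in> A \<Longrightarrow> mv_le x y \<Longrightarrow> plus (mv_minus y x) x = y"
  using lukasiewicz[of x y] by (simp add: mv_le_def mv_minus_def)

lemma mv_le_plus: "x \<in> A \<Longrightarrow> w \<in> A \<Longrightarrow> mv_le x (plus x w)"
  by (simp add: mv_le_def plus_assoc[symmetric] neg_plus_self)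

lemma mv_le_iff_ex: "x \<in> A \<Longrightarrow> y \<in> A \<Longrightarrow> mv_le x y \<longleftrightarrow> (\<exists>w\<in>A. plus x w = y)"
  by (metis mv_le_plus mv_minus_closed mv_minus_plus_of_le plus_commute)

lemma mv_le_trans:
  assumes "x \<in> A" "y \<in> A" "w \<in> A" "mv_le x y" "mv_le y w"
  shows "mv_le x w"
proof -
  obtain p q where "p \<in> A" "plus x p = y" "q \<in> A" "plus y q = w"
    using assms mv_le_iff_ex by metis
  then have "plus x (plus p q) = w" "plus p q \<in> A"
    using assms by (auto simp: plus_assoc[symmetric])
  then show ?thesis
    using assms mv_le_iff_ex by metis
qed

lemma mv_minus_le: "x \<in> A \<Longrightarrow> y \<in> A \<Longrightarrow> mv_le (mv_minus x y) x"
  by (simp add: mv_le_def mv_minus_def plus_ac plus_left_neg_self)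

lemma mv_minus_le_neg: "x \<in> A \<Longrightarrow> y \<in> A \<Longrightarrow> mv_le (mv_minus x y) (neg y)"
  by (simp add: mv_le_def mv_minus_def plus_assoc plus_neg_self)

lemma mv_summable_commute: "mv_summable x y \<Longrightarrow> mv_summable y x"
  by (auto simp: mv_summable_def plus_commute)

lemma mv_summable_zero: "x \<in> A \<Longrightarrow> mv_summable x z"
  by (simp add: mv_summable_def)

lemma mv_summable_neg: "x \<in> A \<Longrightarrow> mv_summable x (neg x)"
  by (simp add: mv_summable_def neg_plus_self)

text \<open>On the real unit interval this reads \<open>1 - y = (1 - (x + y)) + x\<close>. It takes
  the place of cancellation in the lemmas that follow.\<close>

lemma neg_right_of_sum:
  assumes "mv_summable x y"
  shows "neg y = plus (neg (plus x y)) x"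
proof -
  have A: "x \<in> A" "y \<in> A" and xy: "plus (neg x) (neg y) = u"
    using assms by (auto simp: mv_summable_def)
  have "plus (neg (plus x y)) x = plus (neg (plus (neg (neg y)) x)) x"
    using A by (simp add: plus_commute[of x y])
  also have "\<dots> = plus (neg (plus (neg x) (neg y))) (neg y)"
    using A by (intro lukasiewicz) simp_all
  also have "\<dots> = neg y"
    using A by (simp add: xy)
  finally show ?thesis ..
qed

lemma neg_left_of_sum:
  assumes "mv_summable x y"
  shows "neg x = plus (neg (plus x y)) y"
  using neg_right_of_sum[OF mv_summable_commute[OF assms]] assms plus_commute[of y x]
  by (auto simp only: mv_summable_def)

text \<open>Rewriting \<open>neg y\<close>, and then \<open>neg x\<close>, as the complement of the
  sum plus the other summand brings out \<open>plus (neg (plus x y)) (neg w)\<close>, which is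
  \<open>u\<close>.\<close>

lemma mv_summable_assoc:
  assumes "mv_summable x y" "mv_summable (plus x y) w"
  shows "mv_summable y w" "mv_summable x (plus y w)"
proof -
  have A: "x \<in> A" "y \<in> A" "w \<in> A" and xyw: "plus (neg (plus x y)) (neg w) = u"
    using assms by (auto simp: mv_summable_def)
  have "plus (neg y) (neg w) = plus (plus (neg (plus x y)) x) (neg w)"
    by (simp only: neg_right_of_sum[OF assms(1)])
  also have "\<dots> = plus x (plus (neg (plus x y)) (neg w))"
    using A by (simp add: plus_assoc plus_left_commute)
  also have "\<dots> = u"
    using A by (simp only: xyw plus_unit)
  finally show yw: "mv_summable y w"
    using A by (simp only: mv_summable_def)
  have "plus (neg x) (neg (plus y w)) = plus (plus (neg (plus x y)) y) (neg (plus y w))"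
    by (simp only: neg_left_of_sum[OF assms(1)])
  also have "\<dots> = plus (neg (plus x y)) (plus (neg (plus y w)) y)"
    using A by (simp add: plus_ac)
  also have "\<dots> = u"
    by (simp only: neg_right_of_sum[OF yw, symmetric] xyw)
  finally show "mv_summable x (plus y w)"
    using A by (simp add: mv_summable_def)
qed

section \<open>Meets and common refinements\<close>

lemma mv_meet_commute: "x \<in> A \<Longrightarrow> y \<in> A \<Longrightarrow> mv_meet x y = mv_meet y x"
  using lukasiewicz[of "neg y" "neg x"] by (simp add: mv_meet_def mv_minus_def plus_commute)

text \<open>With \<open>d = mv_minus x y\<close> the meet is \<open>mv_minus x d\<close>, which lies
  below \<open>neg d\<close>.\<close>

lemma mv_summable_meet_minus: "x \<in> A \<Longrightarrow> y \<in> A \<Longrightarrow> mv_summable (mv_meet x y) (mv_minus x y)"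
  by (simp add: mv_meet_def mv_minus_le_neg mv_summable_iff_le)

lemma meet_plus_minus: "x \<in> A \<Longrightarrow> y \<in> A \<Longrightarrow> plus (mv_meet x y) (mv_minus x y) = x"
  by (simp add: mv_meet_def mv_minus_le mv_minus_plus_of_le)

text \<open>Let \<open>s\<close> be the common sum. Expanding \<open>neg y\<close> to
  \<open>neg s + x\<close> and contracting \<open>neg s + q\<close> to \<open>neg p\<close> turns
  \<open>neg y + q\<close> into \<open>neg p + x\<close>.\<close>

lemma minus_cross:
  assumes "mv_summable x y" "mv_summable p q" "plus x y = plus p q"
  shows "mv_minus y q = mv_minus p x"
proof -
  have A: "x \<in> A" "y \<in> A" "p \<in> A" "q \<in> A"
    using assms by (auto simp: mv_summable_def)
  have "plus (neg y) q = plus (plus (neg (plus p q)) x) q"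
    by (simp only: neg_right_of_sum[OF assms(1)] assms(3))
  also have "\<dots> = plus (plus (neg (plus p q)) q) x"
    using A by (simp add: plus_ac)
  also have "\<dots> = plus (neg p) x"
    by (simp only: neg_left_of_sum[OF assms(2)])
  finally have "plus (neg y) q = plus (neg p) x" .
  then show ?thesis
    by (simp add: mv_minus_def)
qed

text \<open>The pieces form a two-by-two table with rows \<open>x\<close>, \<open>y\<close> and
  columns \<open>p\<close>, \<open>q\<close>. By \<open>minus_cross\<close> each off-diagonal entry
  is a difference both for its row and for its column, so every row and column splits into a meet
  and a difference.\<close>

lemma riesz_decomposition:
  assumes "mv_summable x y" "mv_summable p q" "plus x y = plus p q"
  obtains a b c d where "mv_summable a b" "mv_summable c d" "mv_summable a c" "mv_summable b d"
    "x = plus a b" "y = plus c d" "p = plus a c" "q = plus b d"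
proof
  let ?a = "mv_meet x p" and ?b = "mv_minus x p" and ?c = "mv_minus p x" and ?d = "mv_meet y q"
  have A: "x \<in> A" "y \<in> A" "p \<in> A" "q \<in> A"
    using assms by (auto simp: mv_summable_def)
  have c: "?c = mv_minus y q" and b: "?b = mv_minus q y"
    using minus_cross assms by metis+
  show "mv_summable ?a ?b" "x = plus ?a ?b"
    using A by (simp_all add: mv_summable_meet_minus meet_plus_minus)
  show "mv_summable ?c ?d"
    using A c by (simp add: mv_summable_meet_minus mv_summable_commute)
  then show "y = plus ?c ?d"
    using A meet_plus_minus[of y q] by (simp add: c plus_commute mv_summable_def)
  show "mv_summable ?a ?c" "p = plus ?a ?c"
    using A by (simp_all add: mv_summable_meet_minus meet_plus_minus mv_meet_commute[of x p])
  show "mv_summable ?b ?d"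
    using A b by (simp add: mv_summable_meet_minus mv_summable_commute mv_meet_commute[of y q])
  then show "q = plus ?b ?d"
    using A meet_plus_minus[of q y]
    by (simp add: b plus_commute mv_meet_commute[of y q] mv_summable_def)
qed

end

section \<open>Additive functions on partial monoids with Riesz decomposition\<close>

text \<open>\<open>D\<close> tells when the partial sum \<open>add\<close> is defined.
  \<open>decomposition\<close> makes infima additive; \<open>directed\<close> completes two elements
  to a common sum and serves the arguments about attained maxima.\<close>

locale riesz_partial_monoid =
  fixes C :: "'a set" and D :: "'a \<Rightarrow> 'a \<Rightarrow> bool" and add :: "'a \<Rightarrow> 'a \<Rightarrow> 'a" and e :: 'a
  assumes D_closed: "D x y \<Longrightarrow> x \<in> C" "D x y \<Longrightarrow> y \<in> C" "D x y \<Longrightarrow> add x y \<in> C"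
    and D_commute: "D x y \<Longrightarrow> D y x"
    and add_commute: "D x y \<Longrightarrow> add x y = add y x"
    and D_zero: "x \<in> C \<Longrightarrow> D x e"
    and add_zero: "x \<in> C \<Longrightarrow> add x e = x"
    and zero_closed: "e \<in> C"
    and D_assoc: "D x y \<Longrightarrow> D (add x y) w \<Longrightarrow> D y w" "D x y \<Longrightarrow> D (add x y) w \<Longrightarrow> D x (add y w)"
    and add_assoc: "D x y \<Longrightarrow> D (add x y) w \<Longrightarrow> add (add x y) w = add x (add y w)"
    and decomposition: "D x y \<Longrightarrow> D p q \<Longrightarrow> add x y = add p q \<Longrightarrow>
      \<exists>a b c d. D a b \<and> D c d \<and> D a c \<and> D b d \<and>
        x = add a b \<and> y = add c d \<and> p = add a c \<and> q = add b d"
    and directed: "x \<in> C \<Longrightarrow> y \<in> C \<Longrightarrow> \<exists>x' y'. D x x' \<and> D y y' \<and> add x x' = add y y'"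
begin

text \<open>Commutativity reads the sum as \<open>add (add w y) x\<close>, to which the given
  direction of associativity applies.\<close>

lemma D_assoc':
  assumes "D y w" "D x (add y w)"
  shows "D x y" "D (add x y) w" "add x (add y w) = add (add x y) w"
proof -
  have 1: "D w y" "D (add w y) x"
    using assms D_commute add_commute by metis+
  then have yx: "D y x" and 2: "D w (add y x)" and eq: "add (add w y) x = add w (add y x)"
    using D_assoc add_assoc by metis+
  show "D x y" using yx by (rule D_commute)
  then have xy: "add x y = add y x" by (rule add_commute)
  show "D (add x y) w" using 2 D_commute xy by metis
  then show "add x (add y w) = add (add x y) w"
    using eq 1 2 assms xy add_commute by metis
qed

text \<open>The sum is rebracketed until \<open>b\<close> and \<open>c\<close> are adjacent, these
  are swapped, and the brackets are moved back; definedness is carried along at each step.\<close>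

lemma exchange:
  assumes "D a b" "D c d" "D (add a b) (add c d)"
  shows "D a c" "D b d" "D (add a c) (add b d)"
    "add (add a b) (add c d) = add (add a c) (add b d)"
proof -
  have 1: "D b (add c d)" "D a (add b (add c d))"
    "add (add a b) (add c d) = add a (add b (add c d))"
    using assms D_assoc add_assoc by blast+
  have 2: "D b c" "D (add b c) d" "add b (add c d) = add (add b c) d"
    using D_assoc'[OF assms(2) 1(1)] by blast+
  have 3: "D c b" "D (add c b) d" "add b c = add c b"
    using 2 D_commute add_commute by metis+
  have 4: "D b d" "D c (add b d)" "add (add c b) d = add c (add b d)"
    using D_assoc[OF 3(1,2)] add_assoc[OF 3(1,2)] by blast+
  have 5: "D a (add c (add b d))"
    using 1 2 3 4 by metis
  show "D b d" by (fact 4)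
  show "D a c" "D (add a c) (add b d)"
    using D_assoc'[OF 4(2) 5] by blast+
  show "add (add a b) (add c d) = add (add a c) (add b d)"
    using D_assoc'(3)[OF 4(2) 5] 1(3) 2(3) 3(3) 4(3) by metis
qed

section \<open>Infimal convolution of additive functions\<close>

definition additive_fun :: "('a \<Rightarrow> real) \<Rightarrow> bool" where
  "additive_fun f \<longleftrightarrow> (\<forall>x y. D x y \<longrightarrow> f (add x y) = f x + f y)"

definition nonneg :: "('a \<Rightarrow> real) \<Rightarrow> bool" where
  "nonneg f \<longleftrightarrow> (\<forall>x\<in>C. 0 \<le> f x)"

definition splittings :: "'a \<Rightarrow> ('a \<times> 'a) set" where
  "splittings x = {(p, q). D p q \<and> add p q = x}"

text \<open>The Riesz-Kantorovich formula. For nonnegative \<open>f\<close> and \<open>g\<close> the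
  values are bounded below by 0, and a point of \<open>C\<close> has a trivial splitting, so the
  real \<open>INF\<close> is then a genuine infimum.\<close>

definition inf_conv :: "('a \<Rightarrow> real) \<Rightarrow> ('a \<Rightarrow> real) \<Rightarrow> 'a \<Rightarrow> real" where
  "inf_conv f g x = (INF (p, q) \<in> splittings x. f p + g q)"

lemma additiveD: "additive_fun f \<Longrightarrow> D x y \<Longrightarrow> f (add x y) = f x + f y"
  by (simp add: additive_fun_def)

lemma additive_zero: "additive_fun f \<Longrightarrow> f e = 0"
  using additiveD[OF _ D_zero[OF zero_closed]] add_zero[OF zero_closed] by force

lemma splittings_trivial: "x \<in> C \<Longrightarrow> (x, e) \<in> splittings x" "x \<in> C \<Longrightarrow> (e, x) \<in> splittings x"
  using D_zero add_zero D_commute add_commute by (fastforce simp: splittings_def)+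

lemma inf_conv_lower:
  assumes "nonneg f" "nonneg g" "D p q"
  shows "inf_conv f g (add p q) \<le> f p + g q"
proof -
  have "bdd_below ((\<lambda>(p, q). f p + g q) ` splittings (add p q))"
    using assms D_closed unfolding nonneg_def splittings_def
    by (intro bdd_belowI2[of _ 0]) (auto intro!: add_nonneg_nonneg)
  moreover have "(p, q) \<in> splittings (add p q)"
    using assms by (simp add: splittings_def)
  ultimately show ?thesis
    unfolding inf_conv_def by (fastforce intro: cINF_lower2)
qed

lemma inf_conv_greatest:
  assumes "x \<in> C" "\<And>p q. D p q \<Longrightarrow> add p q = x \<Longrightarrow> l \<le> f p + g q"
  shows "l \<le> inf_conv f g x"
  unfolding inf_conv_def
proof (rule cINF_greatest)
  show "splittings x \<noteq> {}"
    using splittings_trivial(1)[OF assms(1)] by blast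
qed (use assms(2) in \<open>auto simp: splittings_def\<close>)

text \<open>The trivial splittings of \<open>x\<close> give both bounds, since additive functions
  vanish at \<open>e\<close>.\<close>

lemma inf_conv_le:
  assumes "additive_fun f" "additive_fun g" "nonneg f" "nonneg g" "x \<in> C"
  shows "inf_conv f g x \<le> f x" "inf_conv f g x \<le> g x"
  using inf_conv_lower[OF assms(3,4) D_zero[OF assms(5)]]
    inf_conv_lower[OF assms(3,4) D_commute[OF D_zero[OF assms(5)]]]
    add_zero[OF assms(5)] add_commute[OF D_zero[OF assms(5)]]
    additive_zero[OF assms(1)] additive_zero[OF assms(2)] by auto

text \<open>Every splitting gives \<open>j x = j p + j q\<close>. Here \<open>j\<close> may take
  negative values, as comparison with signed measures requires.\<close>

lemma inf_conv_universal:
  assumes "additive_fun j" "\<And>x. x \<in> C \<Longrightarrow> j x \<le> f x" "\<And>x. x \<in> C \<Longrightarrow> j x \<le> g x" "x \<in> C"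
  shows "j x \<le> inf_conv f g x"
  using assms(4)
proof (rule inf_conv_greatest)
  fix p q assume pq: "D p q" "add p q = x"
  show "j x \<le> f p + g q"
    using additiveD[OF assms(1) pq(1)] assms(2)[OF D_closed(1)[OF pq(1)]]
      assms(3)[OF D_closed(2)[OF pq(1)]] pq(2) by simp
qed

lemma inf_conv_nonneg:
  assumes "nonneg f" "nonneg g"
  shows "nonneg (inf_conv f g)"
  unfolding nonneg_def
proof
  fix x assume "x \<in> C"
  moreover have "additive_fun (\<lambda>x. 0)"
    by (simp add: additive_fun_def)
  ultimately show "0 \<le> inf_conv f g x"
    using assms inf_conv_universal[of "\<lambda>x. 0"] by (simp add: nonneg_def)
qed

text \<open>Subadditivity joins a splitting of \<open>x\<close> and one of \<open>y\<close> by
  \<open>exchange\<close>; superadditivity refines a splitting of the sum by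
  \<open>decomposition\<close>.\<close>

lemma inf_conv_additive:
  assumes "additive_fun f" "additive_fun g" "nonneg f" "nonneg g"
  shows "additive_fun (inf_conv f g)"
  unfolding additive_fun_def
proof (intro allI impI antisym)
  fix x y assume xy: "D x y"
  note [simp] = D_closed[OF xy]
  \<comment> \<open>Moving terms to the left allows the two infima to be treated one after the
    other, first at \<open>x\<close> and then at \<open>y\<close>.\<close>
  have "inf_conv f g (add x y) - inf_conv f g y \<le> inf_conv f g x"
  proof (rule inf_conv_greatest)
    fix p q assume pq: "D p q" "add p q = x"
    have "inf_conv f g (add x y) - (f p + g q) \<le> inf_conv f g y"
    proof (rule inf_conv_greatest)
      fix r s assume rs: "D r s" "add r s = y"
      have ex: "D p r" "D q s" "D (add p r) (add q s)" "add x y = add (add p r) (add q s)"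
        using exchange[OF pq(1) rs(1)] pq rs xy by auto
      have "inf_conv f g (add x y) \<le> f (add p r) + g (add q s)"
        using inf_conv_lower[OF assms(3,4) ex(3)] ex(4) by simp
      then show "inf_conv f g (add x y) - (f p + g q) \<le> f r + g s"
        using additiveD[OF assms(1) ex(1)] additiveD[OF assms(2) ex(2)] by simp
    qed simp
    then show "inf_conv f g (add x y) - inf_conv f g y \<le> f p + g q" by simp
  qed simp
  then show "inf_conv f g (add x y) \<le> inf_conv f g x + inf_conv f g y" by simp
  show "inf_conv f g x + inf_conv f g y \<le> inf_conv f g (add x y)"
  proof (rule inf_conv_greatest)
    fix p q assume pq: "D p q" "add p q = add x y"
    obtain a b c d where *: "D a b" "D c d" "D a c" "D b d"
      "x = add a b" "y = add c d" "p = add a c" "q = add b d"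
      using decomposition[OF xy pq(1) pq(2)[symmetric]] by blast
    show "inf_conv f g x + inf_conv f g y \<le> f p + g q"
      using inf_conv_lower[OF assms(3,4) *(1)] inf_conv_lower[OF assms(3,4) *(2)]
        additiveD[OF assms(1) *(3)] additiveD[OF assms(2) *(4)] *(5-8) by simp
  qed simp
qed

section \<open>Additive functions with a maximum\<close>

definition attains_max :: "('a \<Rightarrow> real) \<Rightarrow> bool" where
  "attains_max f \<longleftrightarrow> (\<exists>a\<in>C. \<forall>x\<in>C. f x \<le> f a)"

lemma additive_mono:
  assumes "additive_fun f" "nonneg f" "D x y"
  shows "f x \<le> f (add x y)"
  using assms additiveD[OF assms(1,3)] D_closed[OF assms(3)] by (simp add: nonneg_def)

text \<open>The maximum points of \<open>f\<close> and \<open>g\<close> may differ; completed to a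
  common sum, they yield by monotonicity one point where both functions are maximal.\<close>

lemma attains_max_add:
  assumes "additive_fun f" "nonneg f" "attains_max f" "additive_fun g" "nonneg g" "attains_max g"
  shows "attains_max (\<lambda>x. f x + g x)"
proof -
  obtain a b where a: "a \<in> C" "\<forall>x\<in>C. f x \<le> f a" and b: "b \<in> C" "\<forall>x\<in>C. g x \<le> g b"
    using assms unfolding attains_max_def by blast
  obtain a' b' where c: "D a a'" "D b b'" "add a a' = add b b'"
    using directed[OF a(1) b(1)] by blast
  have "f a \<le> f (add a a')" "g b \<le> g (add a a')"
    using additive_mono assms c by metis+
  then have "\<forall>x\<in>C. f x + g x \<le> f (add a a') + g (add a a')"
    using a b by (meson add_mono order_trans)
  then show ?thesis
    using D_closed(3)[OF c(1)] unfolding attains_max_def by blast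
qed

text \<open>If \<open>f\<close> is maximal at \<open>a\<close>, then \<open>h \<le> f \<le> 0\<close> on the elements summable with \<open>a\<close>.\<close>

lemma attains_max_dominated:
  assumes f: "additive_fun f" "attains_max f" and h: "additive_fun h" "nonneg h"
    and le: "\<And>x. x \<in> C \<Longrightarrow> h x \<le> f x"
  shows "attains_max h"
proof -
  obtain a where a: "a \<in> C" "\<forall>x\<in>C. f x \<le> f a"
    using f unfolding attains_max_def by blast
  have "h x \<le> h a" if "x \<in> C" for x
  proof -
    obtain a' x' where c: "D a a'" "D x x'" "add a a' = add x x'"
      using directed[OF a(1) \<open>x \<in> C\<close>] by blast
    have "f a' \<le> 0"
      using additiveD[OF f(1) c(1)] a(2) D_closed(3)[OF c(1)] by force
    then have "h a' \<le> 0"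
      using le D_closed(2)[OF c(1)] by force
    then show ?thesis
      using additiveD[OF h(1) c(1)] additive_mono[OF h c(2)] c(3) by simp
  qed
  then show ?thesis
    using a(1) unfolding attains_max_def by blast
qed

end

section \<open>Partial sums in EMV-algebras\<close>

context emv_algebra
begin

abbreviation summable_in :: "'a \<Rightarrow> 'a \<Rightarrow> 'a \<Rightarrow> bool" where
  "summable_in a \<equiv> mv_algebra.mv_summable (emv_interval M a) (\<boxplus>) (emv_neg M a) a"

section \<open>Intervals below idempotents\<close>

lemma emv_order_simps [simp]:
  "carrier (emv_order M) = carrier M" "x \<sqsubseteq>\<^bsub>emv_order M\<^esub> y \<longleftrightarrow> x \<curlywedge> y = x"
  by (simp_all add: emv_order_def)

lemma interval_iff: "x \<in> emv_interval M a \<longleftrightarrow> x \<in> carrier M \<and> x \<curlywedge> a = x"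
  using zero_least by (auto simp: emv_interval_def)

lemma interval_closed: "x \<in> emv_interval M a \<Longrightarrow> x \<in> carrier M"
  by (simp add: interval_iff)

lemma idempotent_closed: "a \<in> emv_idempotents M \<Longrightarrow> a \<in> carrier M"
  by (simp add: emv_idempotents_def)

lemma interval_trans:
  assumes "x \<in> emv_interval M a" "a \<in> emv_interval M b" "b \<in> carrier M"
  shows "x \<in> emv_interval M b"
  using inf_assoc[of x a b] assms by (simp add: interval_iff)

lemma common_idempotent:
  assumes "x \<in> carrier M" "y \<in> carrier M"
  obtains a where "a \<in> emv_idempotents M" "x \<in> emv_interval M a" "y \<in> emv_interval M a"
proof -
  obtain a where a: "a \<in> emv_idempotents M" "x \<curlyvee> y \<in> emv_interval M a"
    using idempotent_above[OF sup_closed[OF assms]] sup_closed[OF assms] by (auto simp: interval_iff)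
  have "x \<in> emv_interval M (x \<curlyvee> y)" "y \<in> emv_interval M (x \<curlyvee> y)"
    using assms inf_sup_absorb[of x y] inf_sup_absorb[of y x] sup_commute[of x y]
    by (simp_all add: interval_iff)
  then show ?thesis
    using a that interval_trans idempotent_closed by blast
qed

text \<open>Justifies the \<open>THE\<close> in \<open>emv_neg\<close>: an axiom gives existence,
  and two least elements coincide because the meet commutes.\<close>

lemma is_emv_neg_emv_neg:
  assumes "a \<in> emv_idempotents M" "x \<in> emv_interval M a"
  shows "is_emv_neg M a x (emv_neg M a x)"
proof -
  obtain y where y: "is_emv_neg M a x y"
    using neg_exists[OF assms] by blast
  moreover have "y' = y" if "is_emv_neg M a x y'" for y'
    using y that inf_commute[of y y'] interval_closed
    by (fastforce simp: is_emv_neg_def least_def)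
  ultimately show ?thesis
    unfolding emv_neg_def by (rule theI)
qed

text \<open>The axioms do not make the lattice order of \<open>M\<close> agree with the natural order of the
  MV-algebras \<open>[0, a]\<close>; it only extends it.\<close>

lemma mv_le_imp_inf:
  assumes "a \<in> emv_idempotents M" "x \<in> emv_interval M a" "y \<in> emv_interval M a"
    "emv_neg M a x \<boxplus> y = a"
  shows "x \<curlywedge> y = x"
proof -
  interpret A: mv_algebra "emv_interval M a" "(\<boxplus>)" "emv_neg M a" "\<^bold>0" a
    using assms(1) by (rule interval_mv)
  \<comment> \<open>By double negation \<open>x\<close> is the least element completing
    \<open>emv_neg M a x\<close> to \<open>a\<close>, and \<open>y\<close> is another such
    element.\<close>
  have "is_emv_neg M a (emv_neg M a x) x"
    using is_emv_neg_emv_neg[OF assms(1) A.neg_closed[OF assms(2)]] A.neg_neg[OF assms(2)] by simp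
  moreover have "y \<boxplus> emv_neg M a x = a"
    using assms A.plus_commute by simp
  ultimately show ?thesis
    using assms(3) by (simp add: is_emv_neg_def least_def)
qed

text \<open>The complements of \<open>y\<close> in \<open>[0, a]\<close> and \<open>[0, b]\<close>
  may differ; they are compared through \<open>d\<close>, the difference of \<open>a\<close> and
  \<open>y\<close> taken in \<open>[0, b]\<close>. The chain goes from \<open>x\<close> over
  \<open>emv_neg M a y\<close> to \<open>d\<close> in \<open>[0, a]\<close>, and from
  \<open>d\<close> to \<open>emv_neg M b y\<close> in \<open>[0, b]\<close>.\<close>

lemma summable_in_mono:
  assumes a: "a \<in> emv_idempotents M" and b: "b \<in> emv_idempotents M"
    and ab: "a \<in> emv_interval M b" and xy: "summable_in a x y"
  shows "summable_in b x y"
proof -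
  interpret A: mv_algebra "emv_interval M a" "(\<boxplus>)" "emv_neg M a" "\<^bold>0" a
    using a by (rule interval_mv)
  interpret B: mv_algebra "emv_interval M b" "(\<boxplus>)" "emv_neg M b" "\<^bold>0" b
    using b by (rule interval_mv)
  have sub: "w \<in> emv_interval M b" if "w \<in> emv_interval M a" for w
    using interval_trans[OF that ab idempotent_closed[OF b]] .
  have x: "x \<in> emv_interval M a" and y: "y \<in> emv_interval M a" and le: "A.mv_le x (emv_neg M a y)"
    using xy unfolding A.mv_summable_iff_le by auto
  define d where "d = B.mv_minus a y"
  have dB: "d \<in> emv_interval M b"
    unfolding d_def using sub[OF y] ab by simp
  \<comment> \<open>The witness is \<open>a\<close> itself, because
    \<open>y \<boxplus> a = a\<close> in \<open>[0, a]\<close>.\<close>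
  have "B.mv_le y a"
    using B.mv_le_iff_ex[OF sub[OF y] ab] ab A.plus_unit[OF y] by blast
  then have dy: "d \<boxplus> y = a"
    unfolding d_def by (rule B.mv_minus_plus_of_le[OF sub[OF y] ab])
  have "B.mv_le d a"
    unfolding d_def using ab sub[OF y] by (rule B.mv_minus_le)
  \<comment> \<open>The natural order of \<open>[0, b]\<close> implies the lattice order, which
    places \<open>d\<close> in \<open>[0, a]\<close>.\<close>
  then have dA: "d \<in> emv_interval M a"
    using mv_le_imp_inf[OF b dB ab] interval_closed[OF dB] by (simp add: B.mv_le_def interval_iff)
  have "A.mv_le (emv_neg M a y) d"
    using y dy A.plus_commute[OF dA y] by (simp add: A.mv_le_def)
  then have "A.mv_le x d"
    using A.mv_le_trans[OF x A.neg_closed[OF y] dA le] by blast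
  \<comment> \<open>The sum is the same in both intervals, so a summand witnessing the order in
    \<open>[0, a]\<close> also witnesses it in \<open>[0, b]\<close>.\<close>
  then obtain w where "w \<in> emv_interval M a" "x \<boxplus> w = d"
    using A.mv_le_iff_ex[OF x dA] by blast
  then have "B.mv_le x d"
    using B.mv_le_iff_ex[OF sub[OF x] dB] sub by blast
  moreover have "B.mv_le d (emv_neg M b y)"
    unfolding d_def using ab sub[OF y] by (rule B.mv_minus_le_neg)
  ultimately have "B.mv_le x (emv_neg M b y)"
    using B.mv_le_trans[OF sub[OF x] dB B.neg_closed[OF sub[OF y]]] by blast
  then show ?thesis
    using sub x y by (simp add: B.mv_summable_iff_le)
qed

section \<open>The partial sum on the whole algebra\<close>

lemma emv_sum_defined_iff:
  "emv_sum_defined M x y \<longleftrightarrow> (\<exists>a\<in>emv_idempotents M. summable_in a x y)"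
  unfolding emv_sum_defined_def emv_times_def
  by (intro bex_cong refl) (simp add: mv_algebra.mv_summable_iff[OF interval_mv])

lemma summable_in_interval:
  assumes "a \<in> emv_idempotents M" "summable_in a x y"
  shows "x \<in> emv_interval M a" "y \<in> emv_interval M a"
  using assms by (simp_all add: mv_algebra.mv_summable_def[OF interval_mv])

lemma common_sum_witness:
  assumes "emv_sum_defined M x y" "emv_sum_defined M p q"
  obtains a where "a \<in> emv_idempotents M" "summable_in a x y" "summable_in a p q"
proof -
  obtain b c where b: "b \<in> emv_idempotents M" "summable_in b x y"
    and c: "c \<in> emv_idempotents M" "summable_in c p q"
    using assms unfolding emv_sum_defined_iff by blast
  obtain a where "a \<in> emv_idempotents M" "b \<in> emv_interval M a" "c \<in> emv_interval M a"
    using common_idempotent[OF idempotent_closed[OF b(1)] idempotent_closed[OF c(1)]] .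
  then show ?thesis
    using that b c summable_in_mono by blast
qed

text \<open>A law involving several sums is checked in one \<open>[0, a]\<close> where all of them
  are defined. For directedness, the complements relative to \<open>a\<close> complete
  \<open>x\<close> and \<open>y\<close> to the same sum \<open>a\<close>.\<close>

sublocale psum: riesz_partial_monoid "carrier M" "emv_sum_defined M" "(\<boxplus>)" "\<^bold>0"
proof
  have mon: "Group.monoid \<lparr>carrier = carrier M, monoid.mult = (\<boxplus>), one = \<^bold>0\<rparr>"
    using plus_comm_monoid by (rule comm_monoid.axioms)
  show "\<^bold>0 \<in> carrier M"
    using monoid.one_closed[OF mon] by simp
  show "x \<boxplus> \<^bold>0 = x" if "x \<in> carrier M" for x
    using monoid.r_one[OF mon, of x] that by simp
  fix x y assume D: "emv_sum_defined M x y"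
  then obtain a where a: "a \<in> emv_idempotents M" "summable_in a x y"
    unfolding emv_sum_defined_iff by blast
  show xy: "x \<in> carrier M" "y \<in> carrier M"
    using summable_in_interval[OF a] interval_closed by blast+
  then show "x \<boxplus> y \<in> carrier M" "x \<boxplus> y = y \<boxplus> x"
    using monoid.m_closed[OF mon, of x y] comm_monoid.m_comm[OF plus_comm_monoid, of x y] by simp_all
  show "emv_sum_defined M y x"
    using a mv_algebra.mv_summable_commute[OF interval_mv] unfolding emv_sum_defined_iff by blast
next
  fix x assume "x \<in> carrier M"
  then obtain a where "a \<in> emv_idempotents M" "x \<in> emv_interval M a"
    using common_idempotent by blast
  then show "emv_sum_defined M x \<^bold>0"
    using mv_algebra.mv_summable_zero[OF interval_mv] unfolding emv_sum_defined_iff by blast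
next
  fix x y w assume "emv_sum_defined M x y" "emv_sum_defined M (x \<boxplus> y) w"
  then obtain a where a: "a \<in> emv_idempotents M" "summable_in a x y" "summable_in a (x \<boxplus> y) w"
    by (rule common_sum_witness)
  show "emv_sum_defined M y w" "emv_sum_defined M x (y \<boxplus> w)"
    using mv_algebra.mv_summable_assoc[OF interval_mv a(2,3)] a(1)
    unfolding emv_sum_defined_iff by blast+
  show "x \<boxplus> y \<boxplus> w = x \<boxplus> (y \<boxplus> w)"
    using mv_algebra.plus_assoc[OF interval_mv] a summable_in_interval by metis
next
  fix x y p q assume *: "emv_sum_defined M x y" "emv_sum_defined M p q" "x \<boxplus> y = p \<boxplus> q"
  obtain s where s: "s \<in> emv_idempotents M" "summable_in s x y" "summable_in s p q"
    using common_sum_witness[OF *(1,2)] .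
  obtain a b c d where "summable_in s a b" "summable_in s c d" "summable_in s a c" "summable_in s b d"
    "x = a \<boxplus> b" "y = c \<boxplus> d" "p = a \<boxplus> c" "q = b \<boxplus> d"
    using mv_algebra.riesz_decomposition[OF interval_mv s(2,3) *(3)] s(1) by blast
  then show "\<exists>a b c d. emv_sum_defined M a b \<and> emv_sum_defined M c d \<and>
      emv_sum_defined M a c \<and> emv_sum_defined M b d \<and>
      x = a \<boxplus> b \<and> y = c \<boxplus> d \<and> p = a \<boxplus> c \<and> q = b \<boxplus> d"
    using s(1) unfolding emv_sum_defined_iff by blast
next
  fix x y assume "x \<in> carrier M" "y \<in> carrier M"
  then obtain a where a: "a \<in> emv_idempotents M" "x \<in> emv_interval M a" "y \<in> emv_interval M a"
    by (rule common_idempotent)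
  show "\<exists>x' y'. emv_sum_defined M x x' \<and> emv_sum_defined M y y' \<and> x \<boxplus> x' = y \<boxplus> y'"
  proof (intro exI conjI)
    show "emv_sum_defined M x (emv_neg M a x)" "emv_sum_defined M y (emv_neg M a y)"
      using mv_algebra.mv_summable_neg[OF interval_mv] a unfolding emv_sum_defined_iff by blast+
    show "x \<boxplus> emv_neg M a x = y \<boxplus> emv_neg M a y"
      using mv_algebra.plus_neg_self[OF interval_mv] a by metis
  qed
qed

section \<open>Strong Jordan signed measures\<close>

lemma measures_iff:
  "m \<in> emv_measures M \<longleftrightarrow> m \<in> extensional (carrier M) \<and> psum.nonneg m \<and> psum.additive_fun m"
  using psum.D_closed
  by (fastforce simp: emv_measures_def PiE_iff psum.nonneg_def psum.additive_fun_def)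

text \<open>An attained supremum is a maximum, so later arguments need only inequalities between
  reals.\<close>

lemma strong_measures_iff:
  "m \<in> emv_strong_measures M \<longleftrightarrow> m \<in> emv_measures M \<and> psum.attains_max m"
proof -
  have "ereal (m a) = (SUP x\<in>carrier M. ereal (m x)) \<longleftrightarrow> (\<forall>x\<in>carrier M. m x \<le> m a)"
    if "a \<in> carrier M" for a
  proof
    assume "ereal (m a) = (SUP x\<in>carrier M. ereal (m x))"
    then show "\<forall>x\<in>carrier M. m x \<le> m a"
      using SUP_upper[of _ "carrier M" "\<lambda>x. ereal (m x)"] by (metis ereal_less_eq(3))
  next
    assume "\<forall>x\<in>carrier M. m x \<le> m a"
    then show "ereal (m a) = (SUP x\<in>carrier M. ereal (m x))"
      using that by (intro antisym SUP_upper2[of a] SUP_least) auto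
  qed
  then show ?thesis
    by (auto simp: emv_strong_measures_def psum.attains_max_def)
qed

lemma strong_measuresD:
  assumes "m \<in> emv_strong_measures M"
  shows "psum.additive_fun m" "psum.nonneg m" "psum.attains_max m"
  using assms by (simp_all add: strong_measures_iff measures_iff)

text \<open>Restriction supplies extensionality and keeps additivity, because a defined sum and its
  summands lie in the carrier.\<close>

lemma restrict_strong_measure:
  assumes "psum.additive_fun f" "psum.nonneg f" "psum.attains_max f"
  shows "restrict f (carrier M) \<in> emv_strong_measures M"
  using assms psum.D_closed
  by (auto simp: strong_measures_iff measures_iff psum.additive_fun_def psum.nonneg_def
      psum.attains_max_def)

lemma strong_measure_add:
  assumes "m \<in> emv_strong_measures M" "n \<in> emv_strong_measures M"
  shows "restrict (\<lambda>x. m x + n x) (carrier M) \<in> emv_strong_measures M"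
proof (rule restrict_strong_measure)
  note m = strong_measuresD[OF assms(1)] and n = strong_measuresD[OF assms(2)]
  show "psum.additive_fun (\<lambda>x. m x + n x)" "psum.nonneg (\<lambda>x. m x + n x)"
    using m n by (simp_all add: psum.additive_fun_def psum.nonneg_def)
  show "psum.attains_max (\<lambda>x. m x + n x)"
    using m n by (rule psum.attains_max_add)
qed

lemma strong_measure_scale:
  assumes "m \<in> emv_strong_measures M" "0 \<le> r"
  shows "restrict (\<lambda>x. r * m x) (carrier M) \<in> emv_strong_measures M"
proof (rule restrict_strong_measure)
  note m = strong_measuresD[OF assms(1)]
  show "psum.additive_fun (\<lambda>x. r * m x)" "psum.nonneg (\<lambda>x. r * m x)"
    using m assms(2) by (simp_all add: psum.additive_fun_def psum.nonneg_def distrib_left)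
  show "psum.attains_max (\<lambda>x. r * m x)"
    using m(3) mult_left_mono[OF _ assms(2)] unfolding psum.attains_max_def by blast
qed

lemma zero_strong_measure: "restrict (\<lambda>x. 0) (carrier M) \<in> emv_strong_measures M"
  using psum.zero_closed
  by (intro restrict_strong_measure)
    (auto simp: psum.additive_fun_def psum.nonneg_def psum.attains_max_def)

lemma strong_measure_inf_conv:
  assumes "m \<in> emv_strong_measures M" "n \<in> emv_strong_measures M"
  shows "restrict (psum.inf_conv m n) (carrier M) \<in> emv_strong_measures M"
proof (rule restrict_strong_measure)
  note m = strong_measuresD[OF assms(1)] and n = strong_measuresD[OF assms(2)]
  show add: "psum.additive_fun (psum.inf_conv m n)" and nn: "psum.nonneg (psum.inf_conv m n)"
    using m n psum.inf_conv_additive psum.inf_conv_nonneg by blast+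
  show "psum.attains_max (psum.inf_conv m n)"
    using psum.attains_max_dominated[OF m(1,3) add nn] psum.inf_conv_le(1)[OF m(1) n(1) m(2) n(2)]
    by blast
qed

section \<open>Linear operations on differences of strong measures\<close>

lemma strong_jordanI:
  assumes "m \<in> emv_strong_measures M" "n \<in> emv_strong_measures M"
    "f \<in> extensional (carrier M)" "\<And>x. x \<in> carrier M \<Longrightarrow> f x = m x - n x"
  shows "f \<in> strong_jordan M"
proof -
  have "f = restrict (\<lambda>x. m x - n x) (carrier M)"
    using assms(3,4) by (intro extensionalityI[of _ "carrier M"]) simp_all
  then show ?thesis
    unfolding strong_jordan_def using assms(1,2) by blast
qed

lemma strong_jordanE:
  assumes "f \<in> strong_jordan M"
  obtains m n where "m \<in> emv_strong_measures M" "n \<in> emv_strong_measures M"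
    "f = restrict (\<lambda>x. m x - n x) (carrier M)"
  using assms unfolding strong_jordan_def by blast

lemma strong_jordan_extensional: "f \<in> strong_jordan M \<Longrightarrow> f \<in> extensional (carrier M)"
  by (auto elim: strong_jordanE)

lemma strong_jordan_additive:
  assumes "f \<in> strong_jordan M"
  shows "psum.additive_fun f"
proof -
  obtain m n where mn: "m \<in> emv_strong_measures M" "n \<in> emv_strong_measures M"
    "f = restrict (\<lambda>x. m x - n x) (carrier M)"
    using assms by (rule strong_jordanE)
  then show ?thesis
    using strong_measuresD(1)[OF mn(1)] strong_measuresD(1)[OF mn(2)] psum.D_closed
    by (simp add: psum.additive_fun_def)
qed

lemma strong_jordan_zero: "restrict (\<lambda>x. 0) (carrier M) \<in> strong_jordan M"
  by (rule strong_jordanI[OF zero_strong_measure zero_strong_measure]) simp_all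

lemma strong_jordan_add:
  assumes "f \<in> strong_jordan M" "g \<in> strong_jordan M"
  shows "restrict (\<lambda>x. f x + g x) (carrier M) \<in> strong_jordan M"
proof -
  obtain m n where f: "m \<in> emv_strong_measures M" "n \<in> emv_strong_measures M"
    "f = restrict (\<lambda>x. m x - n x) (carrier M)"
    using assms(1) by (rule strong_jordanE)
  obtain p q where g: "p \<in> emv_strong_measures M" "q \<in> emv_strong_measures M"
    "g = restrict (\<lambda>x. p x - q x) (carrier M)"
    using assms(2) by (rule strong_jordanE)
  show ?thesis
    by (rule strong_jordanI[OF strong_measure_add[OF f(1) g(1)] strong_measure_add[OF f(2) g(2)]])
      (simp_all add: f(3) g(3))
qed

lemma strong_jordan_scale:
  assumes "f \<in> strong_jordan M"
  shows "restrict (\<lambda>x. r * f x) (carrier M) \<in> strong_jordan M"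
proof -
  obtain m n where f: "m \<in> emv_strong_measures M" "n \<in> emv_strong_measures M"
    "f = restrict (\<lambda>x. m x - n x) (carrier M)"
    using assms by (rule strong_jordanE)
  show ?thesis
  proof (cases "0 \<le> r")
    case True
    show ?thesis
      by (rule strong_jordanI[OF strong_measure_scale[OF f(1) True] strong_measure_scale[OF f(2) True]])
        (simp_all add: f(3) right_diff_distrib)
  next
    \<comment> \<open>For negative \<open>r\<close> the two measures trade places:
      \<open>r * (m - n) = (- r) * n - (- r) * m\<close>.\<close>
    case False
    then have r: "0 \<le> - r" by simp
    show ?thesis
      by (rule strong_jordanI[OF strong_measure_scale[OF f(2) r] strong_measure_scale[OF f(1) r]])
        (simp_all add: f(3) right_diff_distrib)
  qed
qed

section \<open>Infima and suprema of signed measures\<close>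

lemma strong_jordan_inf:
  assumes "f \<in> strong_jordan M" "g \<in> strong_jordan M"
  obtains h where "h \<in> strong_jordan M"
    "\<And>x. x \<in> carrier M \<Longrightarrow> h x \<le> f x" "\<And>x. x \<in> carrier M \<Longrightarrow> h x \<le> g x"
    "\<And>j x. \<lbrakk>j \<in> strong_jordan M; \<forall>x\<in>carrier M. j x \<le> f x; \<forall>x\<in>carrier M. j x \<le> g x;
      x \<in> carrier M\<rbrakk> \<Longrightarrow> j x \<le> h x"
proof -
  obtain m n where f: "m \<in> emv_strong_measures M" "n \<in> emv_strong_measures M"
    "f = restrict (\<lambda>x. m x - n x) (carrier M)"
    using assms(1) by (rule strong_jordanE)
  obtain p q where g: "p \<in> emv_strong_measures M" "q \<in> emv_strong_measures M"
    "g = restrict (\<lambda>x. p x - q x) (carrier M)"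
    using assms(2) by (rule strong_jordanE)
  \<comment> \<open>Translating by \<open>n + q\<close> reduces the infimum of \<open>f\<close> and \<open>g\<close> to that of two measures.\<close>
  define a where "a = restrict (\<lambda>x. m x + q x) (carrier M)"
  define b where "b = restrict (\<lambda>x. p x + n x) (carrier M)"
  define c where "c = restrict (\<lambda>x. n x + q x) (carrier M)"
  have abc: "a \<in> emv_strong_measures M" "b \<in> emv_strong_measures M" "c \<in> emv_strong_measures M"
    unfolding a_def b_def c_def using f g strong_measure_add by blast+
  have fgc: "f x + c x = a x" "g x + c x = b x" if "x \<in> carrier M" for x
    using that by (simp_all add: a_def b_def c_def f(3) g(3))
  define h where "h = restrict (\<lambda>x. psum.inf_conv a b x - c x) (carrier M)"
  note a = strong_measuresD[OF abc(1)] and b = strong_measuresD[OF abc(2)]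
    and c = strong_measuresD[OF abc(3)]
  show ?thesis
  proof
    show "h \<in> strong_jordan M"
      by (rule strong_jordanI[OF strong_measure_inf_conv[OF abc(1,2)] abc(3)]) (simp_all add: h_def)
    show "h x \<le> f x" "h x \<le> g x" if "x \<in> carrier M" for x
      using psum.inf_conv_le[OF a(1) b(1) a(2) b(2) that] fgc[OF that] that
      by (simp_all add: h_def)
    show "j x \<le> h x" if j: "j \<in> strong_jordan M" "\<forall>x\<in>carrier M. j x \<le> f x"
      "\<forall>x\<in>carrier M. j x \<le> g x" and x: "x \<in> carrier M" for j x
    proof -
      \<comment> \<open>\<open>j + c\<close> may be negative somewhere; the universal property of
        the infimal convolution asks for additivity.\<close>
      have "psum.additive_fun (\<lambda>x. j x + c x)"
        using strong_jordan_additive[OF j(1)] c(1) by (simp add: psum.additive_fun_def)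
      moreover have "j x + c x \<le> a x" "j x + c x \<le> b x" if "x \<in> carrier M" for x
        using j that fgc[OF that] by (simp_all flip: fgc[OF that])
      ultimately have "j x + c x \<le> psum.inf_conv a b x"
        using psum.inf_conv_universal[of "\<lambda>x. j x + c x"] x by blast
      then show ?thesis
        using x by (simp add: h_def)
    qed
  qed
qed

lemma strong_jordan_sup:
  assumes "f \<in> strong_jordan M" "g \<in> strong_jordan M"
  obtains h where "h \<in> strong_jordan M"
    "\<And>x. x \<in> carrier M \<Longrightarrow> f x \<le> h x" "\<And>x. x \<in> carrier M \<Longrightarrow> g x \<le> h x"
    "\<And>j x. \<lbrakk>j \<in> strong_jordan M; \<forall>x\<in>carrier M. f x \<le> j x; \<forall>x\<in>carrier M. g x \<le> j x;
      x \<in> carrier M\<rbrakk> \<Longrightarrow> h x \<le> j x"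
proof -
  \<comment> \<open>Negation is written as scaling by \<open>- 1\<close> so that
    \<open>strong_jordan_scale\<close> applies literally.\<close>
  let ?neg = "\<lambda>f. restrict (\<lambda>x. - 1 * f x) (carrier M)"
  obtain h where h: "h \<in> strong_jordan M"
    "\<And>x. x \<in> carrier M \<Longrightarrow> h x \<le> ?neg f x" "\<And>x. x \<in> carrier M \<Longrightarrow> h x \<le> ?neg g x"
    "\<And>j x. \<lbrakk>j \<in> strong_jordan M; \<forall>x\<in>carrier M. j x \<le> ?neg f x;
      \<forall>x\<in>carrier M. j x \<le> ?neg g x; x \<in> carrier M\<rbrakk> \<Longrightarrow> j x \<le> h x"
    using strong_jordan_inf[OF strong_jordan_scale[OF assms(1)] strong_jordan_scale[OF assms(2)]]
    by blast
  show ?thesis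
  proof
    show "?neg h \<in> strong_jordan M"
      by (rule strong_jordan_scale[OF h(1)])
    show "f x \<le> ?neg h x" "g x \<le> ?neg h x" if "x \<in> carrier M" for x
      using h(2,3)[OF that] that by simp_all
    show "?neg h x \<le> j x" if "j \<in> strong_jordan M" "\<forall>x\<in>carrier M. f x \<le> j x"
      "\<forall>x\<in>carrier M. g x \<le> j x" "x \<in> carrier M" for j x
      using h(4)[OF strong_jordan_scale[OF that(1), of "- 1"]] that by force
  qed
qed

text \<open>The pointwise order sees only the carrier; extensionality fixes the values
  elsewhere.\<close>

lemma strong_jordan_antisym:
  assumes "f \<in> strong_jordan M" "g \<in> strong_jordan M"
    "\<forall>x\<in>carrier M. f x \<le> g x" "\<forall>x\<in>carrier M. g x \<le> f x"
  shows "f = g"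
  using assms strong_jordan_extensional
  by (intro extensionalityI[of _ "carrier M"] antisym) simp_all

section \<open>Group, lattice and module structure\<close>

lemma abelian_group_strong_jordan: "abelian_group (strong_jordan_space M)"
proof (rule abelian_groupI)
  fix f assume f: "f \<in> carrier (strong_jordan_space M)"
  show "\<zero>\<^bsub>strong_jordan_space M\<^esub> \<oplus>\<^bsub>strong_jordan_space M\<^esub> f = f"
    using f strong_jordan_extensional[of f]
    by (auto simp: strong_jordan_space_def intro!: extensionalityI[of _ "carrier M"])
  show "\<exists>g\<in>carrier (strong_jordan_space M).
      g \<oplus>\<^bsub>strong_jordan_space M\<^esub> f = \<zero>\<^bsub>strong_jordan_space M\<^esub>"
    using f strong_jordan_scale[of f "- 1"]
    by (intro bexI[of _ "restrict (\<lambda>x. - 1 * f x) (carrier M)"])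
      (auto simp: strong_jordan_space_def cong: restrict_cong)
qed (auto simp: strong_jordan_space_def strong_jordan_zero strong_jordan_add add_ac cong: restrict_cong)

lemma lattice_strong_jordan: "Lattice.lattice (strong_jordan_order M)"
proof
  fix f g assume "f \<in> carrier (strong_jordan_order M)" "g \<in> carrier (strong_jordan_order M)"
  then have fg: "f \<in> strong_jordan M" "g \<in> strong_jordan M"
    by (simp_all add: strong_jordan_order_def)
  obtain s where "s \<in> strong_jordan M"
    "\<And>x. x \<in> carrier M \<Longrightarrow> f x \<le> s x" "\<And>x. x \<in> carrier M \<Longrightarrow> g x \<le> s x"
    "\<And>j x. \<lbrakk>j \<in> strong_jordan M; \<forall>x\<in>carrier M. f x \<le> j x; \<forall>x\<in>carrier M. g x \<le> j x;
      x \<in> carrier M\<rbrakk> \<Longrightarrow> s x \<le> j x"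
    using strong_jordan_sup[OF fg] by blast
  then show "\<exists>s. least (strong_jordan_order M) s (Upper (strong_jordan_order M) {f, g})"
    using fg by (intro exI[of _ s]) (auto simp: least_def Upper_def strong_jordan_order_def)
  obtain i where "i \<in> strong_jordan M"
    "\<And>x. x \<in> carrier M \<Longrightarrow> i x \<le> f x" "\<And>x. x \<in> carrier M \<Longrightarrow> i x \<le> g x"
    "\<And>j x. \<lbrakk>j \<in> strong_jordan M; \<forall>x\<in>carrier M. j x \<le> f x; \<forall>x\<in>carrier M. j x \<le> g x;
      x \<in> carrier M\<rbrakk> \<Longrightarrow> j x \<le> i x"
    using strong_jordan_inf[OF fg] by blast
  then show "\<exists>i. greatest (strong_jordan_order M) i (Lower (strong_jordan_order M) {f, g})"
    using fg by (intro exI[of _ i]) (auto simp: greatest_def Lower_def strong_jordan_order_def)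
qed (auto simp: strong_jordan_order_def intro: order_trans strong_jordan_antisym)

lemma cring_real_ring: "cring real_ring"
proof (rule cringI)
  show "abelian_group real_ring"
    by (rule abelian_groupI) (auto simp: real_ring_def intro: exI[of _ "- x" for x])
  show "Group.comm_monoid real_ring"
    by (rule comm_monoidI) (auto simp: real_ring_def)
qed (simp add: real_ring_def distrib_right)

lemma module_strong_jordan: "Module.module real_ring (strong_jordan_space M)"
proof (rule moduleI[OF cring_real_ring abelian_group_strong_jordan])
  fix f assume f: "f \<in> carrier (strong_jordan_space M)"
  show "\<one>\<^bsub>real_ring\<^esub> \<odot>\<^bsub>strong_jordan_space M\<^esub> f = f"
    using f strong_jordan_extensional[of f]
    by (auto simp: strong_jordan_space_def real_ring_def intro!: extensionalityI[of _ "carrier M"])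
qed (auto simp: strong_jordan_space_def real_ring_def strong_jordan_scale algebra_simps
    cong: restrict_cong)

text \<open>Translation preserves the pointwise order because adding a real number preserves the
  order of the reals.\<close>

lemma l_group_strong_jordan:
  "l_group (add_monoid (strong_jordan_space M)) (strong_jordan_order M)"
proof (intro l_group.intro l_group_axioms.intro)
  show "Group.group (add_monoid (strong_jordan_space M))"
    using abelian_group.a_group[OF abelian_group_strong_jordan] .
qed (rule lattice_strong_jordan, simp_all add: strong_jordan_space_def strong_jordan_order_def)

lemma riesz_space_strong_jordan: "riesz_space (strong_jordan_space M) (strong_jordan_order M)"
  by (intro riesz_space.intro riesz_space_axioms.intro module_strong_jordan lattice_strong_jordan)
    (simp_all add: strong_jordan_space_def strong_jordan_order_def mult_left_mono)

end

theorem theorem6p4: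
  fixes M :: "('a, 'm) emv_scheme"
  assumes "emv_algebra M"
  shows "l_group (add_monoid (strong_jordan_space M)) (strong_jordan_order M)
    \<and> riesz_space (strong_jordan_space M) (strong_jordan_order M)"
  using emv_algebra.l_group_strong_jordan[OF assms] emv_algebra.riesz_space_strong_jordan[OF assms]
  by blast

end
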